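(* Let $G$ be a transitive digraph and $f$ a discrete Morse function on $G$. Then for every $n\ge 0$, $P_n^{\overline{\Phi}}(G)$ is the real linear span of the elements $\alpha+\overline{V}\partial(\alpha)$, where $\alpha$ ranges over the critical $n$-paths on $G$.
   Context: A digraph $G$ consists of a finite vertex set $V$ and a non-empty edge set $E\subseteq V\times V\setminus\mathrm{diag}$; $(u,v)\in E$ is written $u\to v$. $G$ is transitive if for any two edges $u\to v$ and $v\to w$ of $G$ there is an edge $u\to w$ of $G$. $\Lambda_n(V)$ is the real vector space with basis all sequences $v_0\cdots v_n$ of vertices (elementary $n$-paths), with inner product $\langle\cdot,\cdot\rangle$ making elementary paths orthonormal. $\partial:\Lambda_n(V)\to\Lambda_{n-1}(V)$ is $\partial(v_0\cdots v_n)=\sum_{i=0}^n(-1)^i v_0\cdots\widehat{v_i}\cdots v_n$ (zero on $\Lambda_0(V)$). An allowed elementary $n$-path on $G$ is $v_0\cdots v_n$ with $v_{i-1}\to v_i$ an edge for $1\le i\le n$; $P_n(G)\subseteq\Lambda_n(V)$ is their span. For transitive $G$, $\partial$ maps $P_n(G)$ into $P_{n-1}(G)$. For allowed elementary paths, $\alpha>\beta$ (or $\beta<\alpha$) means $\beta$ is obtained from $\alpha$ by removing some vertices; a superscript $(n)$ indicates an $n$-path. For $f:V\to[0,+\infty)$ put $f(v_0\cdots v_n)=\sum_i f(v_i)$. $f$ is a discrete Morse function on $G$ if for every allowed elementary $\alpha^{(n)}$, $\#\{\gamma^{(n+1)}>\alpha \mid f(\gamma)=f(\alpha)\}\le1$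 and $\#\{\beta^{(n-1)}<\alpha \mid f(\beta)=f(\alpha)\}\le1$; $\alpha^{(n)}$ is critical if both numbers are $0$. $\overline{V}=\mathrm{grad} f:P_n(G)\to P_{n+1}(G)$ is the linear map with $\overline{V}(\alpha)=-\langle\partial\gamma,\alpha\rangle\gamma$ if there is an allowed elementary $\gamma^{(n+1)}>\alpha^{(n)}$ with $f(\gamma)=f(\alpha)$, and $\overline{V}(\alpha)=0$ otherwise. The discrete gradient flow is $\overline{\Phi}=\mathrm{Id}+\partial\overline{V}+\overline{V}\partial$. $P_*^{\overline{\Phi}}(G)$ is the sub-chain complex of $P_*(G)$ consisting of all $\overline{\Phi}$-invariant chains: $P_n^{\overline\Phi}(G)=\{x\in P_n(G):\overline\Phi(x)=x\}$. *)

theory Defs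
  imports
    "Graph_Theory.Pair_Digraph"
    "Graph_Theory.Vertex_Walk"
    "HOL-Library.Sublist"
    "HOL-Library.FuncSet"
    "HOL-Analysis.Finite_Function_Topology"
begin

text \<open>
  The sequence $v_0 \cdots v_n$ is the list \<open>[v\<^sub>0, \<dots>, v\<^sub>n]\<close> of length \<open>n + 1\<close>, and real
  chains of all degrees live in the single real vector space \<open>'a list \<Rightarrow>\<^sub>0 real\<close> of finitely
  supported functions; the degree-\<open>n\<close> spaces are subspaces of it.  The empty list is not an
  elementary path.
\<close>

type_synonym 'a chain = "'a list \<Rightarrow>\<^sub>0 real"

abbreviation elem :: "'a list \<Rightarrow> 'a chain" where
  "elem p \<equiv> Poly_Mapping.single p 1"

definition lin_ext :: "('a list \<Rightarrow> 'a chain) \<Rightarrow> 'a chain \<Rightarrow> 'a chain" where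
  "lin_ext g c = (\<Sum>p\<in>Poly_Mapping.keys c. Poly_Mapping.lookup c p *\<^sub>R g p)"

text \<open>The inner product for which the elementary paths are orthonormal.\<close>

definition chain_inner :: "'a chain \<Rightarrow> 'a chain \<Rightarrow> real" where
  "chain_inner c d =
     (\<Sum>p\<in>Poly_Mapping.keys c. Poly_Mapping.lookup c p * Poly_Mapping.lookup d p)"

text \<open>
  The boundary of a 0-path is 0 by convention (and not the empty list, as the alternating sum
  would give).
\<close>

definition boundary_elem :: "'a list \<Rightarrow> 'a chain" where
  "boundary_elem p =
     (if length p \<le> 1 then 0
      else (\<Sum>i<length p. (-1) ^ i *\<^sub>R elem (take i p @ drop (Suc i) p)))"

definition boundary :: "'a chain \<Rightarrow> 'a chain" where
  "boundary = lin_ext boundary_elem"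

text \<open>
  Allowed elementary paths are the vertex walks (\<^const>\<open>vwalk\<close>) of the digraph; these are nonempty
  lists, and \<^const>\<open>vwalk_length\<close> counts edges, so it is the degree \<open>n\<close>.
\<close>

definition allowed_path :: "'a pair_pre_digraph \<Rightarrow> nat \<Rightarrow> 'a list \<Rightarrow> bool" where
  "allowed_path G n p \<longleftrightarrow> vwalk p (with_proj G) \<and> vwalk_length p = n"

definition path_space :: "'a pair_pre_digraph \<Rightarrow> nat \<Rightarrow> 'a chain set" where
  "path_space G n = span (elem ` {p. allowed_path G n p})"

definition path_less :: "'a pair_pre_digraph \<Rightarrow> 'a list \<Rightarrow> 'a list \<Rightarrow> bool" where
  "path_less G \<beta> \<alpha> \<longleftrightarrow>
     vwalk \<beta> (with_proj G) \<and> vwalk \<alpha> (with_proj G) \<and> strict_subseq \<beta> \<alpha>"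

definition path_val :: "('a \<Rightarrow> real) \<Rightarrow> 'a list \<Rightarrow> real" where
  "path_val f p = (\<Sum>v\<leftarrow>p. f v)"

definition upper_paths :: "'a pair_pre_digraph \<Rightarrow> ('a \<Rightarrow> real) \<Rightarrow> nat \<Rightarrow> 'a list \<Rightarrow> 'a list set" where
  "upper_paths G f n \<alpha> =
     {\<gamma>. allowed_path G (n + 1) \<gamma> \<and> path_less G \<alpha> \<gamma> \<and> path_val f \<gamma> = path_val f \<alpha>}"

text \<open>The condition \<open>m + 1 = n\<close> makes this set empty for \<open>n = 0\<close>: there are no (-1)-paths.\<close>

definition lower_paths :: "'a pair_pre_digraph \<Rightarrow> ('a \<Rightarrow> real) \<Rightarrow> nat \<Rightarrow> 'a list \<Rightarrow> 'a list set" where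
  "lower_paths G f n \<alpha> =
     {\<beta>. (\<exists>m. m + 1 = n \<and> allowed_path G m \<beta>) \<and> path_less G \<beta> \<alpha> \<and> path_val f \<beta> = path_val f \<alpha>}"

definition discrete_morse :: "'a pair_pre_digraph \<Rightarrow> ('a \<Rightarrow> real) \<Rightarrow> bool" where
  "discrete_morse G f \<longleftrightarrow>
     f \<in> pverts G \<rightarrow> {0..} \<and>
     (\<forall>n \<alpha>. allowed_path G n \<alpha> \<longrightarrow>
        card (upper_paths G f n \<alpha>) \<le> 1 \<and> card (lower_paths G f n \<alpha>) \<le> 1)"

definition critical_path :: "'a pair_pre_digraph \<Rightarrow> ('a \<Rightarrow> real) \<Rightarrow> nat \<Rightarrow> 'a list \<Rightarrow> bool" where
  "critical_path G f n \<alpha> \<longleftrightarrow>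
     allowed_path G n \<alpha> \<and> card (upper_paths G f n \<alpha>) = 0 \<and> card (lower_paths G f n \<alpha>) = 0"

text \<open>
  For a discrete Morse function the path \<open>\<gamma>\<close> below is unique.  The map is only meaningful on the
  span of the allowed paths; elementary paths that are not allowed are sent to 0, because
  \<^const>\<open>path_less\<close> relates allowed paths only.
\<close>

definition grad_elem :: "'a pair_pre_digraph \<Rightarrow> ('a \<Rightarrow> real) \<Rightarrow> 'a list \<Rightarrow> 'a chain" where
  "grad_elem G f \<alpha> =
     (let S = upper_paths G f (vwalk_length \<alpha>) \<alpha> in
      if S \<noteq> {}
      then (let \<gamma> = (THE \<gamma>. \<gamma> \<in> S) in
              (- chain_inner (boundary (elem \<gamma>)) (elem \<alpha>)) *\<^sub>R elem \<gamma>)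
      else 0)"

definition grad :: "'a pair_pre_digraph \<Rightarrow> ('a \<Rightarrow> real) \<Rightarrow> 'a chain \<Rightarrow> 'a chain" where
  "grad G f = lin_ext (grad_elem G f)"

definition gradient_flow :: "'a pair_pre_digraph \<Rightarrow> ('a \<Rightarrow> real) \<Rightarrow> 'a chain \<Rightarrow> 'a chain" where
  "gradient_flow G f x = x + boundary (grad G f x) + grad G f (boundary x)"

definition invariant_chains :: "'a pair_pre_digraph \<Rightarrow> ('a \<Rightarrow> real) \<Rightarrow> nat \<Rightarrow> 'a chain set" where
  "invariant_chains G f n = {x \<in> path_space G n. gradient_flow G f x = x}"

end

theory Submission
  imports Defs
begin

text \<open>
  Two vertices of value 0 on a path with at least one edge would violate the Morse condition from
  below, so \<open>V\<close> acts by inserting the only possible vertex of value 0 and kills every path that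
  already contains one.  Hence \<open>V V = 0\<close>, and \<open>V \<partial> \<gamma> = - \<gamma>\<close> for every \<open>\<gamma>\<close> in the image of the
  matching, so \<open>V \<partial> V = - V\<close>.  Applying \<open>V\<close> to \<open>\<partial> V x + V \<partial> x = 0\<close> therefore
  gives \<open>V x = 0\<close> and then \<open>V \<partial> x = 0\<close>: the invariant chains are those with \<open>V x = 0\<close> and
  \<open>V \<partial> x = 0\<close>.  For such \<open>x\<close>, expand \<open>x = x + V \<partial> x = \<Sum> x\<^sub>p (p + V \<partial> p)\<close>.  The terms with \<open>p\<close>
  matched downwards vanish because \<open>V \<partial> p = - p\<close>, and \<open>x\<^sub>p = 0\<close> for \<open>p\<close> matched upwards with \<open>\<gamma>\<close>
  because \<open>x\<^sub>p\<close> is, up to sign, the coefficient of \<open>\<gamma>\<close> in \<open>V x = 0\<close>.  Only critical \<open>p\<close> remain.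
\<close>

section \<open>Coefficients, linear extension and supports of chains\<close>

lemma lookup_scaleR:
  fixes c :: "'b \<Rightarrow>\<^sub>0 real"
  shows "Poly_Mapping.lookup (r *\<^sub>R c) p = r * Poly_Mapping.lookup c p"
proof -
  have "finite {p. r *\<^sub>R Poly_Mapping.lookup c p \<noteq> 0}"
    by (rule finite_subset[OF _ finite_keys[of c]]) (auto simp: in_keys_iff)
  then show ?thesis
    by (simp add: scaleR_poly_mapping_def)
qed

text \<open>Paths outside the support contribute 0. Enlarging the index set lets \<open>c\<close>,
  \<open>d\<close> and \<open>c + d\<close>, whose supports differ, be summed over one common finite
  set.\<close>

lemma lin_ext_superset:
  assumes "finite S" "Poly_Mapping.keys c \<subseteq> S"
  shows "lin_ext g c = (\<Sum>p\<in>S. Poly_Mapping.lookup c p *\<^sub>R g p)"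
  unfolding lin_ext_def using assms
  by (intro sum.mono_neutral_left) (auto simp: in_keys_iff)

lemma linear_lin_ext:
  fixes g :: "'a list \<Rightarrow> 'a chain"
  shows "linear (lin_ext g)"
proof (rule linearI)
  fix c d :: "'a chain"
  let ?S = "Poly_Mapping.keys c \<union> Poly_Mapping.keys d"
  have "Poly_Mapping.keys (c + d) \<subseteq> ?S"
    by (rule Poly_Mapping.keys_add)
  then show "lin_ext g (c + d) = lin_ext g c + lin_ext g d"
    by (simp add: lin_ext_superset[of ?S] lookup_add scaleR_add_left sum.distrib)
next
  fix r and c :: "'a chain"
  have "Poly_Mapping.keys (r *\<^sub>R c) \<subseteq> Poly_Mapping.keys c"
    by (auto simp: in_keys_iff lookup_scaleR)
  then show "lin_ext g (r *\<^sub>R c) = r *\<^sub>R lin_ext g c"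
    by (simp add: lin_ext_superset[of "Poly_Mapping.keys c"] lookup_scaleR scaleR_sum_right)
qed

lemma lin_ext_elem [simp]: "lin_ext g (elem p) = g p"
  by (simp add: lin_ext_def)

lemma lin_ext_elem_self: "lin_ext elem c = c"
proof (rule poly_mapping_eqI)
  fix q
  show "Poly_Mapping.lookup (lin_ext elem c) q = Poly_Mapping.lookup c q"
    by (simp add: lin_ext_def lookup_sum lookup_scaleR lookup_single when_def in_keys_iff
        if_distrib[of "\<lambda>r. _ * r"] cong: if_cong)
qed

lemma lin_ext_in_span:
  assumes "\<And>p. p \<in> Poly_Mapping.keys c \<Longrightarrow> g p \<in> span T"
  shows "lin_ext g c \<in> span T"
  unfolding lin_ext_def using assms by (intro span_sum span_scale)

text \<open>The chains supported in \<open>S\<close> form a subspace containing the generators. This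
  recovers allowedness of each path in the support from membership in
  \<open>path_space\<close>.\<close>

lemma keys_in_span_elem:
  assumes "c \<in> span (elem ` S)"
  shows "Poly_Mapping.keys c \<subseteq> S"
proof -
  have "subspace {c :: 'a chain. Poly_Mapping.keys c \<subseteq> S}"
  proof (rule subspaceI)
    fix c d :: "'a chain"
    assume "c \<in> {c. Poly_Mapping.keys c \<subseteq> S}" "d \<in> {c. Poly_Mapping.keys c \<subseteq> S}"
    then show "c + d \<in> {c. Poly_Mapping.keys c \<subseteq> S}"
      using Poly_Mapping.keys_add[of c d] by blast
  qed (auto simp: in_keys_iff lookup_scaleR)
  then have "span (elem ` S) \<subseteq> {c. Poly_Mapping.keys c \<subseteq> S}"
    by (intro span_minimal) auto
  with assms show ?thesis
    by blast
qed

lemma linear_boundary: "linear boundary"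
  and linear_grad: "linear (grad G f)"
  by (simp_all add: boundary_def grad_def linear_lin_ext)

lemma linear_gradient_flow: "linear (gradient_flow G f)"
proof -
  have "gradient_flow G f = (\<lambda>x. x + (boundary \<circ> grad G f) x + (grad G f \<circ> boundary) x)"
    by (auto simp: gradient_flow_def)
  then show ?thesis
    using linear_boundary linear_grad
    by (simp only:) (intro linear_compose_add linear_id[unfolded id_def] linear_compose)
qed

section \<open>Faces of a list obtained by removing one entry\<close>

definition remove_nth :: "nat \<Rightarrow> 'b list \<Rightarrow> 'b list" where
  "remove_nth i p = take i p @ drop (Suc i) p"

lemma length_remove_nth: "i < length p \<Longrightarrow> length (remove_nth i p) = length p - 1"
  by (simp add: remove_nth_def)

lemma set_remove_nth:
  assumes "distinct p" "i < length p"
  shows "set (remove_nth i p) = set p - {p ! i}"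
proof -
  have p: "p = take i p @ p ! i # drop (Suc i) p"
    using assms id_take_nth_drop by blast
  then have "distinct (take i p @ p ! i # drop (Suc i) p)"
    using assms by simp
  moreover have "set p = set (take i p @ p ! i # drop (Suc i) p)"
    using p by simp
  ultimately show ?thesis
    by (auto simp: remove_nth_def)
qed

text \<open>Distinctness lets the vertex set of a face reveal which vertex was removed, so faces at
  different positions never coincide.\<close>

lemma remove_nth_inject:
  assumes "distinct p" "i < length p" "j < length p" "remove_nth i p = remove_nth j p"
  shows "i = j"
proof -
  have "set p - {p ! i} = set p - {p ! j}"
    using assms set_remove_nth by metis
  then have "p ! i = p ! j"
    using assms nth_mem by blast
  then show ?thesis
    using assms nth_eq_iff_index_eq by blast
qed

lemma path_val_remove_nth:
  assumes "i < length p"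
  shows "path_val f p = path_val f (remove_nth i p) + f (p ! i)"
proof -
  have "path_val f p = path_val f (take i p @ p ! i # drop (Suc i) p)"
    using assms id_take_nth_drop by metis
  then show ?thesis
    by (simp add: remove_nth_def path_val_def)
qed

lemma strict_subseq_remove_nth:
  assumes "i < length p"
  shows "strict_subseq (remove_nth i p) p"
proof -
  have "subseq (take i p @ drop (Suc i) p) (take i p @ drop i p)"
    using Cons_nth_drop_Suc[OF assms]
    by (metis subseq_append' subseq_Cons' subseq_order.order_refl)
  moreover have "remove_nth i p \<noteq> p"
    using assms length_remove_nth[OF assms] by auto
  ultimately show ?thesis
    by (simp add: strict_subseq_def remove_nth_def)
qed

text \<open>Induction on the embedding: once an entry of \<open>q\<close> is skipped, the remaining
  lists have equal length and must agree. Comparable paths in consecutive degrees are thus given by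
  a removed position.\<close>

lemma subseq_remove_nth:
  assumes "subseq p q" "length q = Suc (length p)"
  shows "\<exists>i<length q. p = remove_nth i q"
  using assms
proof (induction p q rule: list_emb.induct)
  case (list_emb_Nil q)
  then show ?case
    by (auto simp: remove_nth_def)
next
  case (list_emb_Cons p q y)
  then have "p = q"
    by (auto simp: subseq_same_length)
  then show ?case
    by (auto simp: remove_nth_def intro: exI[of _ 0])
next
  case (list_emb_Cons2 x y p q)
  then obtain i where "i < length q" "p = remove_nth i q"
    by auto
  then show ?case
    using list_emb_Cons2 by (intro exI[of _ "Suc i"]) (simp add: remove_nth_def)
qed

lemma boundary_elem_remove_nth:
  "2 \<le> length p \<Longrightarrow>
    boundary (elem p) = (\<Sum>i<length p. (-1) ^ i *\<^sub>R elem (remove_nth i p))"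
  by (simp add: boundary_def boundary_elem_def remove_nth_def)

section \<open>Allowed paths in a loopless transitive digraph\<close>

locale morse_digraph = pair_digraph G for G :: "'a pair_pre_digraph" +
  fixes f :: "'a \<Rightarrow> real"
  assumes trans_arcs: "trans (parcs G)"
    and morse: "discrete_morse G f"
begin

text \<open>Transitivity extends the edges between consecutive vertices to all ordered pairs of
  positions, a condition that passes to every sublist.\<close>

lemma vwalk_iff_sorted_wrt:
  "vwalk p (with_proj G) \<longleftrightarrow>
    p \<noteq> [] \<and> set p \<subseteq> pverts G \<and> sorted_wrt (\<lambda>u v. (u, v) \<in> parcs G) p"
proof -
  have "transp (\<lambda>u v. (u, v) \<in> parcs G)"
    using trans_arcs by (auto intro: transpI dest: transD)
  then have "set (vwalk_arcs p) \<subseteq> parcs G \<longleftrightarrow> sorted_wrt (\<lambda>u v. (u, v) \<in> parcs G) p"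
    by (induction p rule: vwalk_arcs.induct) (simp_all add: sorted_wrt1 sorted_wrt2 del: sorted_wrt.simps(2))
  then show ?thesis
    by (auto simp: vwalk_def)
qed

text \<open>A repeated vertex would be joined to itself by an edge, which is a loop.\<close>

lemma vwalk_distinct:
  assumes "vwalk p (with_proj G)"
  shows "distinct p"
proof -
  have "sorted_wrt (\<lambda>u v. (u, v) \<in> parcs G) p"
    using assms by (simp add: vwalk_iff_sorted_wrt)
  then have "sorted_wrt (\<noteq>) p"
    by (rule sorted_wrt_mono_rel[rotated]) (auto dest: pair_no_loops)
  then show ?thesis
    by (induction p) auto
qed

lemma vwalk_remove_nth:
  assumes "vwalk p (with_proj G)" "2 \<le> length p" "i < length p"
  shows "vwalk (remove_nth i p) (with_proj G)"
proof -
  have "sorted_wrt (\<lambda>u v. (u, v) \<in> parcs G) (take i p @ p ! i # drop (Suc i) p)"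
    using assms id_take_nth_drop[of i p] by (simp add: vwalk_iff_sorted_wrt)
  then have "sorted_wrt (\<lambda>u v. (u, v) \<in> parcs G) (remove_nth i p)"
    by (auto simp: remove_nth_def sorted_wrt_append)
  moreover have "remove_nth i p \<noteq> []"
    using assms length_remove_nth[of i p] by auto
  moreover have "set (remove_nth i p) \<subseteq> set p"
    using set_take_subset set_drop_subset by (force simp: remove_nth_def)
  ultimately show ?thesis
    using assms by (auto simp: vwalk_iff_sorted_wrt)
qed

section \<open>The matching of paths that differ by a vertex of value zero\<close>

definition zero_face :: "'a list \<Rightarrow> 'a list \<Rightarrow> bool" where
  "zero_face \<beta> \<gamma> \<longleftrightarrow> vwalk \<gamma> (with_proj G) \<and> 2 \<le> length \<gamma> \<and>
     (\<exists>i<length \<gamma>. \<beta> = remove_nth i \<gamma> \<and> f (\<gamma> ! i) = 0)"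

text \<open>Removing a vertex lowers the path value by the value of that vertex, so the path value
  is kept exactly when a vertex of value 0 is removed.\<close>

lemma zero_face_iff:
  "zero_face \<beta> \<gamma> \<longleftrightarrow>
    path_less G \<beta> \<gamma> \<and> length \<gamma> = Suc (length \<beta>) \<and> path_val f \<beta> = path_val f \<gamma>"
proof
  assume "zero_face \<beta> \<gamma>"
  then obtain i where i: "vwalk \<gamma> (with_proj G)" "2 \<le> length \<gamma>" "i < length \<gamma>"
    "\<beta> = remove_nth i \<gamma>" "f (\<gamma> ! i) = 0"
    by (auto simp: zero_face_def)
  then show "path_less G \<beta> \<gamma> \<and> length \<gamma> = Suc (length \<beta>) \<and> path_val f \<beta> = path_val f \<gamma>"
    by (auto simp: path_less_def vwalk_remove_nth strict_subseq_remove_nth length_remove_nth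
        path_val_remove_nth[of i \<gamma>])
next
  assume r: "path_less G \<beta> \<gamma> \<and> length \<gamma> = Suc (length \<beta>) \<and> path_val f \<beta> = path_val f \<gamma>"
  then obtain i where "i < length \<gamma>" "\<beta> = remove_nth i \<gamma>"
    using subseq_remove_nth[of \<beta> \<gamma>] by (auto simp: path_less_def strict_subseq_def)
  \<comment> \<open>Allowed paths are nonempty, which supplies the bound
    \<open>2 \<le> length \<gamma>\<close> in \<open>zero_face\<close>.\<close>
  moreover have "1 \<le> length \<beta>"
    using r by (cases \<beta>) (auto simp: path_less_def vwalk_def)
  ultimately show "zero_face \<beta> \<gamma>"
    using r path_val_remove_nth[of i \<gamma> f]
    by (auto simp: zero_face_def path_less_def)
qed

lemma zero_face_remove_nth:
  "vwalk \<gamma> (with_proj G) \<Longrightarrow> 2 \<le> length \<gamma> \<Longrightarrow> i < length \<gamma> \<Longrightarrow> f (\<gamma> ! i) = 0 \<Longrightarrow>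
    zero_face (remove_nth i \<gamma>) \<gamma>"
  by (auto simp: zero_face_def)

lemma upper_paths_eq:
  "upper_paths G f (vwalk_length \<alpha>) \<alpha> = {\<gamma>. zero_face \<alpha> \<gamma>}"
  by (cases \<alpha>) (auto simp: upper_paths_def zero_face_iff allowed_path_def path_less_def vwalk_def)

lemma lower_paths_eq:
  "lower_paths G f (vwalk_length \<alpha>) \<alpha> = {\<beta>. zero_face \<beta> \<alpha>}"
  by (auto simp: lower_paths_def zero_face_iff allowed_path_def path_less_def vwalk_def
      neq_Nil_conv)

text \<open>Since \<open>card\<close> of an infinite set is 0, the cardinality conditions yield
  uniqueness or emptiness only once finiteness is known. Here the candidates are lists of one fixed
  length over finitely many vertices.\<close>

lemma finite_upper: "finite {\<gamma>. zero_face \<alpha> \<gamma>}"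
  by (rule finite_subset[OF _ finite_lists_length_eq[OF pair_finite_verts, of "Suc (length \<alpha>)"]])
    (auto simp: zero_face_iff path_less_def vwalk_def)

lemma finite_lower: "finite {\<beta>. zero_face \<beta> \<alpha>}"
  by (rule finite_subset[of _ "(\<lambda>i. remove_nth i \<alpha>) ` {..<length \<alpha>}"])
    (auto simp: zero_face_def)

lemma zero_face_upper_unique:
  assumes "zero_face \<alpha> \<gamma>" "zero_face \<alpha> \<gamma>'"
  shows "\<gamma> = \<gamma>'"
proof -
  have "allowed_path G (vwalk_length \<alpha>) \<alpha>"
    using assms by (simp add: allowed_path_def zero_face_iff path_less_def)
  then have "card {\<gamma>. zero_face \<alpha> \<gamma>} \<le> 1"
    using morse unfolding discrete_morse_def upper_paths_eq[symmetric] by blast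
  then show ?thesis
    using assms card_le_Suc0_iff_eq[OF finite_upper] by auto
qed

text \<open>Two positions of value 0 would give two faces of equal path value. The Morse bound from
  below identifies these faces, and distinctness of the vertices then identifies the
  positions.\<close>

lemma zero_vertex_unique:
  assumes "vwalk p (with_proj G)" "2 \<le> length p" "i < length p" "j < length p"
    and "f (p ! i) = 0" "f (p ! j) = 0"
  shows "i = j"
proof -
  have "allowed_path G (vwalk_length p) p"
    using assms by (simp add: allowed_path_def)
  then have "card {\<beta>. zero_face \<beta> p} \<le> 1"
    using morse unfolding discrete_morse_def lower_paths_eq[symmetric] by blast
  then have "remove_nth i p = remove_nth j p"
    using assms zero_face_remove_nth card_le_Suc0_iff_eq[OF finite_lower] by auto
  then show ?thesis
    using assms remove_nth_inject vwalk_distinct by blast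
qed

lemma zero_face_lower_unique: "zero_face \<beta> \<gamma> \<Longrightarrow> zero_face \<beta>' \<gamma> \<Longrightarrow> \<beta> = \<beta>'"
  using zero_vertex_unique by (auto simp: zero_face_def)

lemma critical_path_iff:
  "critical_path G f n \<alpha> \<longleftrightarrow>
    allowed_path G n \<alpha> \<and> (\<nexists>\<gamma>. zero_face \<alpha> \<gamma>) \<and> (\<nexists>\<beta>. zero_face \<beta> \<alpha>)"
proof (cases "allowed_path G n \<alpha>")
  case True
  then have n: "n = vwalk_length \<alpha>"
    by (simp add: allowed_path_def)
  show ?thesis
    unfolding critical_path_def n upper_paths_eq lower_paths_eq
    using finite_upper finite_lower by simp
qed (simp add: critical_path_def)

section \<open>The gradient on elementary paths and on their boundaries\<close>

lemma grad_elem_remove_nth: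
  assumes "vwalk \<gamma> (with_proj G)" "2 \<le> length \<gamma>" "i < length \<gamma>" "f (\<gamma> ! i) = 0"
  shows "grad_elem G f (remove_nth i \<gamma>) = - ((-1) ^ i *\<^sub>R elem \<gamma>)"
proof -
  let ?\<alpha> = "remove_nth i \<gamma>"
  have upper: "upper_paths G f (vwalk_length ?\<alpha>) ?\<alpha> = {\<gamma>}"
    unfolding upper_paths_eq using assms zero_face_remove_nth zero_face_upper_unique by blast
  have "Poly_Mapping.lookup (boundary (elem \<gamma>)) ?\<alpha> =
      (\<Sum>j<length \<gamma>. if j = i then (-1) ^ j else 0)"
    unfolding boundary_elem_remove_nth[OF assms(2)] lookup_sum
  proof (rule sum.cong[OF refl])
    fix j assume "j \<in> {..<length \<gamma>}"
    \<comment> \<open>The faces of \<open>\<gamma>\<close> are pairwise different, so a single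
      boundary term determines the coefficient.\<close>
    then have "remove_nth j \<gamma> = ?\<alpha> \<longleftrightarrow> j = i"
      using assms vwalk_distinct remove_nth_inject by blast
    then show "Poly_Mapping.lookup ((-1) ^ j *\<^sub>R elem (remove_nth j \<gamma>)) ?\<alpha> =
        (if j = i then (-1) ^ j else 0)"
      by (simp add: lookup_scaleR lookup_single when_def)
  qed
  also have "\<dots> = (-1) ^ i"
    using assms by simp
  finally have coeff: "Poly_Mapping.lookup (boundary (elem \<gamma>)) ?\<alpha> = (-1) ^ i" .
  \<comment> \<open>\<open>chain_inner\<close> sums over the support of its first argument, so the
    face has to be located there.\<close>
  then have "?\<alpha> \<in> Poly_Mapping.keys (boundary (elem \<gamma>))"
    by (simp add: in_keys_iff)
  then have "chain_inner (boundary (elem \<gamma>)) (elem ?\<alpha>) = (-1) ^ i"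
    by (simp add: chain_inner_def lookup_single when_def coeff
        if_distrib[of "\<lambda>r. _ * r"] cong: if_cong)
  then show ?thesis
    by (simp add: grad_elem_def upper del: vwalk_length_simp)
qed

lemma grad_elem_eq_0: "(\<And>\<gamma>. \<not> zero_face \<alpha> \<gamma>) \<Longrightarrow> grad_elem G f \<alpha> = 0"
  by (simp add: grad_elem_def upper_paths_eq del: vwalk_length_simp)

text \<open>An upper partner would contain the inserted vertex of value 0 besides \<open>z\<close>,
  giving two such vertices on one path.\<close>

lemma grad_elem_zero_vertex:
  assumes "z \<in> set \<alpha>" "f z = 0"
  shows "grad_elem G f \<alpha> = 0"
proof (rule grad_elem_eq_0)
  fix \<gamma>
  show "\<not> zero_face \<alpha> \<gamma>"
  proof
    assume "zero_face \<alpha> \<gamma>"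
    then obtain i where i: "vwalk \<gamma> (with_proj G)" "2 \<le> length \<gamma>" "i < length \<gamma>"
      "\<alpha> = remove_nth i \<gamma>" "f (\<gamma> ! i) = 0"
      by (auto simp: zero_face_def)
    then have "z \<in> set \<gamma> - {\<gamma> ! i}"
      using assms set_remove_nth vwalk_distinct by blast
    then obtain j where "j < length \<gamma>" "z = \<gamma> ! j" "z \<noteq> \<gamma> ! i"
      by (auto simp: in_set_conv_nth)
    then show False
      using i assms zero_vertex_unique by blast
  qed
qed

lemma grad_elem_zero_face:
  assumes "zero_face \<beta> \<gamma>"
  obtains \<epsilon> :: real where "\<epsilon> \<noteq> 0" "grad_elem G f \<beta> = \<epsilon> *\<^sub>R elem \<gamma>"
proof -
  obtain i where "grad_elem G f \<beta> = - ((-1) ^ i *\<^sub>R elem \<gamma>)"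
    using assms grad_elem_remove_nth by (auto simp: zero_face_def)
  then show thesis
    using that[of "- ((-1) ^ i)"] by simp
qed

lemma grad_elem_upper_eq_0:
  assumes "zero_face \<beta> \<gamma>"
  shows "grad_elem G f \<gamma> = 0"
  using assms grad_elem_zero_vertex nth_mem by (auto simp: zero_face_def)

text \<open>Every face except the one omitting the zero vertex still contains that vertex and is
  killed by \<open>grad\<close>. For the remaining face the boundary sign \<open>(-1) ^ i\<close>
  meets the gradient sign \<open>- ((-1) ^ i)\<close>, with product -1.\<close>

lemma grad_boundary_elem_upper:
  assumes "zero_face \<beta> \<gamma>"
  shows "grad G f (boundary (elem \<gamma>)) = - elem \<gamma>"
proof -
  obtain i where i: "vwalk \<gamma> (with_proj G)" "2 \<le> length \<gamma>" "i < length \<gamma>" "f (\<gamma> ! i) = 0"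
    using assms by (auto simp: zero_face_def)
  have other: "grad_elem G f (remove_nth j \<gamma>) = 0" if "j < length \<gamma>" "j \<noteq> i" for j
  proof (rule grad_elem_zero_vertex)
    show "\<gamma> ! i \<in> set (remove_nth j \<gamma>)"
      using that i vwalk_distinct[OF i(1)] by (simp add: set_remove_nth nth_eq_iff_index_eq)
  qed (use i in simp)
  have "grad G f (boundary (elem \<gamma>)) =
      (\<Sum>j<length \<gamma>. (-1) ^ j *\<^sub>R grad_elem G f (remove_nth j \<gamma>))"
    by (simp add: boundary_elem_remove_nth[OF i(2)] linear_sum[OF linear_grad]
        linear_scale[OF linear_grad]) (simp add: grad_def)
  also have "\<dots> = (\<Sum>j<length \<gamma>. if j = i then - elem \<gamma> else 0)"
    using other grad_elem_remove_nth[OF i]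
    by (intro sum.cong) (auto simp flip: power_mult_distrib)
  also have "\<dots> = - elem \<gamma>"
    using i by simp
  finally show ?thesis .
qed

section \<open>Operator identities and chains fixed by the flow\<close>

lemma linear_comp_grad:
  assumes "linear h"
  shows "h (grad G f x) =
    (\<Sum>p\<in>Poly_Mapping.keys x. Poly_Mapping.lookup x p *\<^sub>R h (grad_elem G f p))"
  by (simp add: grad_def lin_ext_def linear_sum[OF assms] linear_scale[OF assms])

lemma grad_grad: "grad G f (grad G f x) = 0"
proof -
  have "grad G f (grad_elem G f p) = 0" for p
  proof (cases "\<exists>\<gamma>. zero_face p \<gamma>")
    case True
    then obtain \<gamma> where \<gamma>: "zero_face p \<gamma>" ..
    then obtain \<epsilon> where "grad_elem G f p = \<epsilon> *\<^sub>R elem \<gamma>"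
      using grad_elem_zero_face by blast
    then show ?thesis
      using grad_elem_upper_eq_0[OF \<gamma>]
      by (simp add: linear_scale[OF linear_grad]) (simp add: grad_def)
  qed (simp add: grad_elem_eq_0 linear_0[OF linear_grad])
  then show ?thesis
    by (simp add: linear_comp_grad[OF linear_grad])
qed

lemma grad_boundary_grad: "grad G f (boundary (grad G f x)) = - grad G f x"
proof -
  have linear: "linear (\<lambda>c. grad G f (boundary c))"
    using linear_compose[OF linear_boundary linear_grad] by (simp add: comp_def)
  have "grad G f (boundary (grad_elem G f p)) = - grad_elem G f p" for p
  proof (cases "\<exists>\<gamma>. zero_face p \<gamma>")
    case True
    then obtain \<gamma> where \<gamma>: "zero_face p \<gamma>" ..
    then obtain \<epsilon> where "grad_elem G f p = \<epsilon> *\<^sub>R elem \<gamma>"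
      using grad_elem_zero_face by blast
    then show ?thesis
      using grad_boundary_elem_upper[OF \<gamma>] linear_scale[OF linear] by simp
  qed (simp add: grad_elem_eq_0 linear_0[OF linear])
  then show ?thesis
    by (simp add: linear_comp_grad[OF linear]) (simp add: grad_def lin_ext_def sum_negf)
qed

lemma gradient_flow_fixed_iff:
  "gradient_flow G f x = x \<longleftrightarrow> grad G f x = 0 \<and> grad G f (boundary x) = 0"
proof
  assume "gradient_flow G f x = x"
  then have sum0: "boundary (grad G f x) + grad G f (boundary x) = 0"
    by (simp add: gradient_flow_def add.assoc)
  have "grad G f (boundary (grad G f x) + grad G f (boundary x)) = - grad G f x"
    by (simp add: linear_add[OF linear_grad] grad_boundary_grad grad_grad)
  then have "grad G f x = 0"
    by (simp add: sum0 linear_0[OF linear_grad])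
  then show "grad G f x = 0 \<and> grad G f (boundary x) = 0"
    using sum0 by (simp add: linear_0[OF linear_boundary])
qed (simp add: gradient_flow_def linear_0[OF linear_boundary])

text \<open>A path has at most one zero face, so different lower paths have different upper
  partners. Hence only \<open>p\<close> contributes to the coefficient of \<open>\<gamma>\<close> in
  \<open>grad G f x\<close>, with a nonzero factor.\<close>

lemma lookup_grad_zero_face:
  assumes "zero_face p \<gamma>" "grad G f x = 0"
  shows "Poly_Mapping.lookup x p = 0"
proof -
  obtain \<epsilon> where \<epsilon>: "\<epsilon> \<noteq> 0" "grad_elem G f p = \<epsilon> *\<^sub>R elem \<gamma>"
    using assms grad_elem_zero_face by blast
  have other: "Poly_Mapping.lookup (grad_elem G f q) \<gamma> = 0" if "q \<noteq> p" for q
  proof (cases "\<exists>\<delta>. zero_face q \<delta>")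
    case True
    then obtain \<delta> where \<delta>: "zero_face q \<delta>" ..
    then obtain \<epsilon> where "grad_elem G f q = \<epsilon> *\<^sub>R elem \<delta>"
      using grad_elem_zero_face by blast
    moreover have "\<delta> \<noteq> \<gamma>"
      using \<delta> assms that zero_face_lower_unique by blast
    ultimately show ?thesis
      by (simp add: lookup_scaleR lookup_single)
  qed (simp add: grad_elem_eq_0)
  \<comment> \<open>Adding \<open>p\<close> lets the sum collapse to its term at \<open>p\<close>
    whether or not \<open>p\<close> lies in the support of \<open>x\<close>.\<close>
  let ?S = "insert p (Poly_Mapping.keys x)"
  have "0 = Poly_Mapping.lookup (grad G f x) \<gamma>"
    using assms by simp
  also have "grad G f x = (\<Sum>q\<in>?S. Poly_Mapping.lookup x q *\<^sub>R grad_elem G f q)"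
    unfolding grad_def by (rule lin_ext_superset) auto
  also have "Poly_Mapping.lookup \<dots> \<gamma> =
      (\<Sum>q\<in>?S. Poly_Mapping.lookup x q * Poly_Mapping.lookup (grad_elem G f q) \<gamma>)"
    by (simp only: lookup_sum lookup_scaleR)
  also have "\<dots> = (\<Sum>q\<in>?S. if q = p then Poly_Mapping.lookup x p * \<epsilon> else 0)"
    using other \<epsilon> by (intro sum.cong) (auto simp: lookup_scaleR)
  also have "\<dots> = Poly_Mapping.lookup x p * \<epsilon>"
    by simp
  finally show ?thesis
    using \<epsilon> by simp
qed

section \<open>Degrees, and the span of the critical generators\<close>

lemma grad_path_space:
  assumes "x \<in> path_space G n"
  shows "grad G f x \<in> path_space G (Suc n)"
  unfolding grad_def path_space_def
proof (rule lin_ext_in_span)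
  fix p assume "p \<in> Poly_Mapping.keys x"
  then have p: "allowed_path G n p"
    using assms keys_in_span_elem by (fastforce simp: path_space_def)
  show "grad_elem G f p \<in> span (elem ` {p. allowed_path G (Suc n) p})"
  proof (cases "\<exists>\<gamma>. zero_face p \<gamma>")
    case True
    then obtain \<gamma> where \<gamma>: "zero_face p \<gamma>" ..
    then obtain \<epsilon> where "grad_elem G f p = \<epsilon> *\<^sub>R elem \<gamma>"
      using grad_elem_zero_face by blast
    moreover have "allowed_path G (Suc n) \<gamma>"
      using p \<gamma> by (cases p) (auto simp: allowed_path_def zero_face_iff path_less_def vwalk_def)
    ultimately show ?thesis
      by (auto intro: span_scale span_base)
  qed (simp add: grad_elem_eq_0 span_zero)
qed

lemma grad_boundary_elem_path_space:
  assumes "allowed_path G n p"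
  shows "grad G f (boundary (elem p)) \<in> path_space G n"
proof (cases n)
  case 0
  \<comment> \<open>In degree 0 the boundary vanishes by convention; in higher degrees all faces are
    allowed by transitivity.\<close>
  then have "boundary (elem p) = 0"
    using assms by (simp add: boundary_def boundary_elem_def allowed_path_def)
  then show ?thesis
    by (simp add: linear_0[OF linear_grad] path_space_def span_zero)
next
  case (Suc m)
  then have p: "vwalk p (with_proj G)" "2 \<le> length p" "length p = Suc (Suc m)"
    using assms by (auto simp: allowed_path_def)
  then have "allowed_path G m (remove_nth i p)" if "i < length p" for i
    using that by (simp add: allowed_path_def vwalk_remove_nth length_remove_nth)
  then have "boundary (elem p) \<in> path_space G m"
    unfolding boundary_elem_remove_nth[OF p(2)] path_space_def
    by (auto intro!: span_sum span_scale intro: span_base)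
  then show ?thesis
    using Suc grad_path_space by simp
qed

text \<open>With V for \<open>grad\<close> and D for \<open>boundary\<close>: V p = 0 as p has no
  upper partner, so V (p + V D p) = 0 by V V = 0, and V D (p + V D p) = V D p - V D p = 0 by V D V =
  - V.\<close>

lemma critical_generator_invariant:
  assumes "critical_path G f n p"
  shows "elem p + grad G f (boundary (elem p)) \<in> invariant_chains G f n"
proof -
  have p: "allowed_path G n p" "grad G f (elem p) = 0"
    using assms by (simp_all add: critical_path_iff grad_elem_eq_0 grad_def)
  have "elem p \<in> path_space G n"
    using p by (auto simp: path_space_def intro: span_base)
  then have "elem p + grad G f (boundary (elem p)) \<in> path_space G n"
    using grad_boundary_elem_path_space[OF p(1)] by (simp add: path_space_def span_add)
  then show ?thesis
    by (simp add: invariant_chains_def gradient_flow_fixed_iff linear_add[OF linear_grad]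
        linear_add[OF linear_boundary] p grad_grad grad_boundary_grad)
qed

lemma subspace_invariant_chains: "subspace (invariant_chains G f n)"
  by (rule subspaceI)
    (simp_all add: invariant_chains_def path_space_def span_zero span_add span_scale
      linear_0[OF linear_gradient_flow] linear_add[OF linear_gradient_flow]
      linear_scale[OF linear_gradient_flow])

lemma invariant_chain_in_span:
  assumes "x \<in> invariant_chains G f n"
  shows "x \<in> span ((\<lambda>\<alpha>. elem \<alpha> + grad G f (boundary (elem \<alpha>))) ` {\<alpha>. critical_path G f n \<alpha>})"
    (is "x \<in> span (?g ` ?C)")
proof -
  have x: "grad G f x = 0" "grad G f (boundary x) = 0"
    using assms by (simp_all add: invariant_chains_def gradient_flow_fixed_iff)
  \<comment> \<open>This map fixes \<open>x\<close>, and linearity turns the expansion of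
    \<open>x\<close> in elementary paths into one in the generators.\<close>
  have linear: "linear (\<lambda>c. c + grad G f (boundary c))"
    using linear_compose_add[OF linear_id linear_compose[OF linear_boundary linear_grad]]
    by (simp add: comp_def)
  have "x = lin_ext elem x + grad G f (boundary (lin_ext elem x))"
    by (simp add: lin_ext_elem_self x)
  also have "\<dots> = lin_ext ?g x"
    unfolding lin_ext_def by (simp only: linear_sum[OF linear] linear_scale[OF linear])
  also have "\<dots> \<in> span (?g ` ?C)"
  proof (rule lin_ext_in_span)
    fix p assume p: "p \<in> Poly_Mapping.keys x"
    then have "allowed_path G n p"
      using assms keys_in_span_elem by (fastforce simp: path_space_def invariant_chains_def)
    moreover have "\<nexists>\<gamma>. zero_face p \<gamma>"
      using p x lookup_grad_zero_face by (auto simp: in_keys_iff)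
    ultimately consider "critical_path G f n p" | \<beta> where "zero_face \<beta> p"
      by (auto simp: critical_path_iff)
    then show "?g p \<in> span (?g ` ?C)"
    proof cases
      case 1
      then show ?thesis
        by (auto intro: span_base)
    next
      case 2
      then show ?thesis
        by (simp add: grad_boundary_elem_upper span_zero)
    qed
  qed
  finally show ?thesis .
qed

end

theorem proposition4p6:
  fixes G :: "'a pair_pre_digraph" and f :: "'a \<Rightarrow> real" and n :: nat
  assumes "pair_digraph G" and "parcs G \<noteq> {}"
    and "trans (parcs G)"
    and "discrete_morse G f"
  shows "invariant_chains G f n =
    span ((\<lambda>\<alpha>. elem \<alpha> + grad G f (boundary (elem \<alpha>))) ` {\<alpha>. critical_path G f n \<alpha>})"
proof -
  interpret morse_digraph G f
    using assms by (intro morse_digraph.intro morse_digraph_axioms.intro)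
  show ?thesis (is "_ = span ?gens")
  proof
    show "invariant_chains G f n \<subseteq> span ?gens"
      using invariant_chain_in_span by blast
    show "span ?gens \<subseteq> invariant_chains G f n"
      using critical_generator_invariant
      by (intro span_minimal subspace_invariant_chains) blast
  qed
qed

end
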